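(* Let $A$ be a finite ring with multiplicative group of units $A^*$, and for $n\ge0$ let $A^{(n)}=\{(a_1,\dots,a_n)\in A^n : a_ia_j=a_ja_i \text{ for } 1\le i,j\le n\}$. Let $A^*$ act on $A^{(n)}$ by $u\cdot(a_1,\dots,a_n)=(ua_1u^{-1},\dots,ua_nu^{-1})$, and let $c_A(n)$ be the number of orbits of this action. Then the generating function $h_A(t)=\sum_{n=0}^\infty c_A(n)t^n$ is a rational function of $t$. *)

theory Defs
  imports
    "HOL-Algebra.Ring"
    "HOL-Algebra.Group_Action"
    "HOL-Computational_Algebra.Polynomial_FPS"
begin

text \<open>Rings are the associative unital rings of HOL-Algebra; the trivial ring is included.
  An \<open>n\<close>-tuple is a list of length \<open>n\<close>.\<close>

definition commuting_tuples :: "('a, 'b) ring_scheme \<Rightarrow> nat \<Rightarrow> 'a list set" where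
  "commuting_tuples A n =
     {as. length as = n \<and> set as \<subseteq> carrier A \<and>
          (\<forall>i<n. \<forall>j<n. as ! i \<otimes>\<^bsub>A\<^esub> as ! j = as ! j \<otimes>\<^bsub>A\<^esub> as ! i)}"

text \<open>The restriction to \<open>commuting_tuples A n\<close> makes the maps extensional, as
  \<open>group_action\<close> requires.\<close>

definition conj_action ::
    "('a, 'b) ring_scheme \<Rightarrow> nat \<Rightarrow> 'a \<Rightarrow> 'a list \<Rightarrow> 'a list" where
  "conj_action A n u =
     (\<lambda>as \<in> commuting_tuples A n. map (\<lambda>a. u \<otimes>\<^bsub>A\<^esub> a \<otimes>\<^bsub>A\<^esub> inv\<^bsub>A\<^esub> u) as)"

definition orbit_count :: "('a, 'b) ring_scheme \<Rightarrow> nat \<Rightarrow> nat" where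
  "orbit_count A n =
     card (orbits (units_of A) (commuting_tuples A n) (conj_action A n))"

definition orbit_gf :: "('a, 'b) ring_scheme \<Rightarrow> rat fps" where
  "orbit_gf A = Abs_fps (\<lambda>n. of_nat (orbit_count A n))"

text \<open>A power series over a field is rational if it is the expansion at \<open>0\<close> of a quotient of
  polynomials. The denominator is required to be invertible as a power series, so that \<open>/\<close> on
  \<open>fps\<close> is the genuine quotient.\<close>

definition rational_fps :: "'a::field fps \<Rightarrow> bool" where
  "rational_fps f \<longleftrightarrow>
     (\<exists>p q. coeff q 0 \<noteq> 0 \<and> f = fps_of_poly p / fps_of_poly q)"

lemma (in ring) conj_mult:
  assumes "u \<in> Units R" "a \<in> carrier R" "b \<in> carrier R"
  shows "(u \<otimes> a \<otimes> inv u) \<otimes> (u \<otimes> b \<otimes> inv u) = u \<otimes> (a \<otimes> b) \<otimes> inv u"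
proof -
  have "(u \<otimes> a \<otimes> inv u) \<otimes> (u \<otimes> b \<otimes> inv u) = u \<otimes> a \<otimes> ((inv u \<otimes> u) \<otimes> (b \<otimes> inv u))"
    using assms by (simp add: m_assoc Units_closed del: Units_l_inv)
  with assms show ?thesis by (simp add: m_assoc Units_closed)
qed

lemma (in ring) conj_action_closed:
  assumes "u \<in> Units R" "as \<in> commuting_tuples R n"
  shows "conj_action R n u as \<in> commuting_tuples R n"
  using assms
  by (auto simp: conj_action_def commuting_tuples_def conj_mult subset_iff Units_closed)

lemma (in ring) conj_action_mult:
  assumes "u \<in> Units R" "v \<in> Units R" "as \<in> commuting_tuples R n"
  shows "conj_action R n (u \<otimes> v) as = conj_action R n u (conj_action R n v as)"
proof -
  have "(u \<otimes> v) \<otimes> (inv v \<otimes> inv u) = u \<otimes> ((v \<otimes> inv v) \<otimes> inv u)"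
    using assms by (simp add: m_assoc Units_closed del: Units_r_inv)
  moreover have "(inv v \<otimes> inv u) \<otimes> (u \<otimes> v) = inv v \<otimes> ((inv u \<otimes> u) \<otimes> v)"
    using assms by (simp add: m_assoc Units_closed del: Units_l_inv)
  ultimately have "inv (u \<otimes> v) = inv v \<otimes> inv u"
    using assms by (intro inv_unique'[symmetric]) (simp_all add: Units_closed)
  then show ?thesis
    using assms conj_action_closed[OF assms(2,3)]
    by (auto simp: conj_action_def commuting_tuples_def m_assoc Units_closed subset_iff)
qed

lemma (in ring) conj_action_one:
  assumes "as \<in> commuting_tuples R n"
  shows "conj_action R n \<one> as = as"
  using assms by (auto simp: conj_action_def commuting_tuples_def subset_iff intro!: map_idI)

lemma (in ring) group_action_conj:
  "group_action (units_of R) (commuting_tuples R n) (conj_action R n)"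
proof -
  have Bij: "conj_action R n u \<in> Bij (commuting_tuples R n)" if u: "u \<in> Units R" for u
  proof -
    have "bij_betw (conj_action R n u) (commuting_tuples R n) (commuting_tuples R n)"
      using u by (intro bij_betw_byWitness[where f' = "conj_action R n (inv u)"])
        (auto simp: conj_action_mult[symmetric] conj_action_one conj_action_closed)
    then show ?thesis by (simp add: Bij_def conj_action_def)
  qed
  have "conj_action R n (u \<otimes> v) =
      compose (commuting_tuples R n) (conj_action R n u) (conj_action R n v)"
    if "u \<in> Units R" "v \<in> Units R" for u v
    using that
    by (intro extensionalityI[where A = "commuting_tuples R n"])
      (simp_all add: conj_action_mult compose_def, simp add: conj_action_def)
  with Bij show ?thesis
    by (auto simp: group_action_def group_hom_def group_hom_axioms_def hom_def units_group
          group_BijGroup units_of_carrier units_of_mult)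
      (simp_all add: BijGroup_def)
qed

end

theory Submission
  imports Defs
begin

text \<open>By Burnside's lemma, \<open>c\<^sub>A(n)\<close> is, up to the factor \<open>1 / card A\<^sup>*\<close>, the sum over the units
  \<open>u\<close> of the number of commuting \<open>n\<close>-tuples fixed by \<open>u\<close>. Whether a tuple is commuting and fixed
  by \<open>u\<close> depends only on the set of its entries, and the number of \<open>n\<close>-tuples with a given set \<open>T\<close>
  of entries is, by inclusion-exclusion, a linear combination of the geometric sequences \<open>k\<^sup>n\<close>
  with \<open>k \<le> card T\<close>.\<close>

text \<open>A nonzero constant coefficient makes \<open>fps_of_poly q\<close> a unit, so the
  quotient can be cleared. The closure properties below then reduce to ring identities between
  products.\<close>

lemma rational_fps_iff:
  "rational_fps f \<longleftrightarrow> (\<exists>p q. coeff q 0 \<noteq> 0 \<and> f * fps_of_poly q = fps_of_poly p)"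
proof -
  have "f = fps_of_poly p / fps_of_poly q \<longleftrightarrow> f * fps_of_poly q = fps_of_poly p"
    if "coeff q 0 \<noteq> 0" for p q :: "'a poly"
  proof -
    have q: "fps_nth (fps_of_poly q) 0 \<noteq> 0" using that by simp
    show ?thesis
      using q inverse_mult_eq_1[OF q]
      by (auto simp: fps_divide_unit mult.assoc inverse_mult_eq_1' dest!: sym[of "f * _"])
  qed
  then show ?thesis unfolding rational_fps_def by blast
qed

lemma rational_fps_of_poly [simp]: "rational_fps (fps_of_poly p)"
  unfolding rational_fps_iff by (rule exI[of _ p], rule exI[of _ 1]) simp

lemma rational_fps_const [simp]: "rational_fps (fps_const c)"
  using rational_fps_of_poly[of "[:c:]"] by (simp add: fps_of_poly_const)

lemma rational_fps_add:
  assumes "rational_fps f" "rational_fps g"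
  shows "rational_fps (f + g)"
proof -
  obtain p q where pq: "coeff q 0 \<noteq> 0" "f * fps_of_poly q = fps_of_poly p"
    using assms(1) unfolding rational_fps_iff by blast
  obtain r s where rs: "coeff s 0 \<noteq> 0" "g * fps_of_poly s = fps_of_poly r"
    using assms(2) unfolding rational_fps_iff by blast
  have "(f + g) * fps_of_poly (q * s) = fps_of_poly (p * s + r * q)"
    unfolding fps_of_poly_mult fps_of_poly_add pq(2)[symmetric] rs(2)[symmetric]
    by (simp add: algebra_simps)
  moreover have "coeff (q * s) 0 \<noteq> 0" using pq(1) rs(1) by (simp add: coeff_mult_0)
  ultimately show ?thesis unfolding rational_fps_iff by blast
qed

lemma rational_fps_mult:
  assumes "rational_fps f" "rational_fps g"
  shows "rational_fps (f * g)"
proof -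
  obtain p q where pq: "coeff q 0 \<noteq> 0" "f * fps_of_poly q = fps_of_poly p"
    using assms(1) unfolding rational_fps_iff by blast
  obtain r s where rs: "coeff s 0 \<noteq> 0" "g * fps_of_poly s = fps_of_poly r"
    using assms(2) unfolding rational_fps_iff by blast
  have "f * g * fps_of_poly (q * s) = fps_of_poly (p * r)"
    unfolding fps_of_poly_mult pq(2)[symmetric] rs(2)[symmetric] by (simp add: algebra_simps)
  moreover have "coeff (q * s) 0 \<noteq> 0" using pq(1) rs(1) by (simp add: coeff_mult_0)
  ultimately show ?thesis unfolding rational_fps_iff by blast
qed

lemma rational_fps_diff:
  assumes "rational_fps f" "rational_fps g"
  shows "rational_fps (f - g)"
  using rational_fps_add[OF assms(1) rational_fps_mult[OF rational_fps_const[of "- 1"] assms(2)]]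
  by (simp add: fps_const_neg[symmetric] del: fps_const_neg)

lemma rational_fps_sum:
  assumes "\<And>x. x \<in> X \<Longrightarrow> rational_fps (f x)"
  shows "rational_fps (sum f X)"
  using assms
proof (induction X rule: infinite_finite_induct)
  case (insert x X)
  then show ?case by (simp add: rational_fps_add)
\<comment> \<open>Over an infinite \<open>X\<close> the sum is 0 by convention, so this case is
  settled together with the empty sum.\<close>
qed (use rational_fps_const[of 0] in simp_all)

lemma rational_fps_geometric: "rational_fps (Abs_fps (\<lambda>n. c ^ n))"
proof -
  have "Abs_fps (\<lambda>n. c ^ n) * fps_of_poly [:1, - c:] = fps_of_poly 1"
  proof (rule fps_ext)
    fix n
    show "fps_nth (Abs_fps (\<lambda>n. c ^ n) * fps_of_poly [:1, - c:]) n = fps_nth (fps_of_poly 1) n"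
      by (cases n) (simp_all add: fps_of_poly_linear' distrib_left mult.assoc[symmetric])
  qed
  moreover have "coeff [:1, - c:] 0 \<noteq> 0" by simp
  ultimately show ?thesis unfolding rational_fps_iff by blast
qed

text \<open>Supplies the finiteness needed both for counting a disjoint union and for Burnside's
  lemma.\<close>

lemma finite_lists_set_in_length_eq:
  assumes "finite \<F>" "\<And>T. T \<in> \<F> \<Longrightarrow> finite T"
  shows "finite {xs. length xs = n \<and> set xs \<in> \<F>}"
  using assms
  by (intro finite_subset[OF _ finite_lists_length_eq[of "\<Union>\<F>" n]]) auto

lemma card_lists_set_in_length_eq:
  assumes "finite \<F>" "\<And>T. T \<in> \<F> \<Longrightarrow> finite T"
  shows "card {xs. length xs = n \<and> set xs \<in> \<F>} =
    (\<Sum>T\<in>\<F>. card {xs. length xs = n \<and> set xs = T})"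
proof -
  have "{xs. length xs = n \<and> set xs \<in> \<F>} = (\<Union>T\<in>\<F>. {xs. length xs = n \<and> set xs = T})"
    by auto
  moreover have "finite {xs. length xs = n \<and> set xs = T}" if "T \<in> \<F>" for T
    using finite_lists_set_in_length_eq[of "{T}" n] assms(2)[OF that] by simp
  ultimately show ?thesis
    using assms(1) by (simp add: card_UN_disjoint disjoint_iff)
qed

text \<open>Inclusion-exclusion in recursive form: sorting all tuples over \<open>T\<close> by their
  entry set and isolating the summand \<open>U = T\<close> leaves a geometric series minus the
  series of the proper subsets, which are rational by induction.\<close>

lemma rational_fps_card_lists_set_eq:
  assumes "finite T"
  shows "rational_fps (Abs_fps (\<lambda>n. of_nat (card {xs. length xs = n \<and> set xs = T})) :: 'a::field fps)"
    (is "rational_fps (?g T)")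
  using assms
proof (induction T rule: finite_psubset_induct)
  case (psubset T)
  have "card T ^ n = (\<Sum>U\<in>Pow T. card {xs. length xs = n \<and> set xs = U})" for n
  proof -
    have "{xs. length xs = n \<and> set xs \<in> Pow T} = {xs. set xs \<subseteq> T \<and> length xs = n}"
      by auto
    then show ?thesis
      using card_lists_set_in_length_eq[of "Pow T" n] psubset.hyps
      by (simp add: card_lists_length_eq finite_subset)
  qed
  moreover have "Pow T = insert T {U. U \<subset> T}" "finite {U. U \<subset> T}"
    using psubset.hyps by (auto intro: finite_subset[of _ "Pow T"])
  ultimately have "?g T = Abs_fps (\<lambda>n. of_nat (card T) ^ n) - (\<Sum>U | U \<subset> T. ?g U)"
    by (intro fps_ext) (simp add: fps_sum_nth flip: of_nat_power of_nat_sum)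
  moreover have "rational_fps (\<Sum>U | U \<subset> T. ?g U)"
    by (rule rational_fps_sum) (use psubset.IH in blast)
  ultimately show ?case
    by (simp only: rational_fps_diff rational_fps_geometric)
qed

lemma rational_fps_card_lists_set_in:
  assumes "finite \<F>" "\<And>T. T \<in> \<F> \<Longrightarrow> finite T"
  shows "rational_fps (Abs_fps (\<lambda>n. of_nat (card {xs. length xs = n \<and> set xs \<in> \<F>})) :: 'a::field fps)"
proof -
  have "Abs_fps (\<lambda>n. of_nat (card {xs. length xs = n \<and> set xs \<in> \<F>})) =
      (\<Sum>T\<in>\<F>. Abs_fps (\<lambda>n. of_nat (card {xs. length xs = n \<and> set xs = T})) :: 'a fps)"
    by (rule fps_ext) (simp add: fps_sum_nth card_lists_set_in_length_eq[OF assms])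
  then show ?thesis
    by (simp add: assms rational_fps_card_lists_set_eq rational_fps_sum)
qed

text \<open>Neither length nor positions occur here, so one finite family describes the commuting
  tuples for every \<open>n\<close> at once.\<close>

definition commuting_sets :: "('a, 'b) ring_scheme \<Rightarrow> 'a set set" where
  "commuting_sets A = {T. T \<subseteq> carrier A \<and> (\<forall>a\<in>T. \<forall>b\<in>T. a \<otimes>\<^bsub>A\<^esub> b = b \<otimes>\<^bsub>A\<^esub> a)}"

lemma commuting_tuples_eq:
  "commuting_tuples A n = {as. length as = n \<and> set as \<in> commuting_sets A}"
  unfolding commuting_tuples_def commuting_sets_def by (auto simp: all_set_conv_all_nth)

text \<open>A tuple is fixed by \<open>map f\<close> exactly when \<open>f\<close> fixes each entry,
  so being fixed by \<open>u\<close> is again a condition on the entry set, with a family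
  independent of \<open>n\<close>.\<close>

lemma invariants_conj_action:
  "invariants (commuting_tuples A n) (conj_action A n) u =
    {as. length as = n \<and>
         set as \<in> {T \<in> commuting_sets A. \<forall>a\<in>T. u \<otimes>\<^bsub>A\<^esub> a \<otimes>\<^bsub>A\<^esub> inv\<^bsub>A\<^esub> u = a}}"
proof -
  have "map f as = as \<longleftrightarrow> (\<forall>a\<in>set as. f a = a)" for f :: "'a \<Rightarrow> 'a" and as
    by (induction as) auto
  then show ?thesis
    unfolding invariants_def conj_action_def by (auto simp: commuting_tuples_eq)
qed

theorem theorem5:
  fixes A :: "('a, 'b) ring_scheme"
  assumes "ring A"
    and "finite (carrier A)"
  shows "rational_fps (orbit_gf A)"
proof -
  interpret ring A by fact
  let ?I = "\<lambda>u n. invariants (commuting_tuples A n) (conj_action A n) u"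
  have sets: "finite (commuting_sets A)" "\<And>T. T \<in> commuting_sets A \<Longrightarrow> finite T"
    using assms(2) by (auto simp: commuting_sets_def intro: finite_subset)
  have units: "finite (Units A)" "Units A \<noteq> {}"
    using assms(2) by (auto simp: Units_def intro: finite_subset)
  have "orbit_count A n * card (Units A) = (\<Sum>u\<in>Units A. card (?I u n))" for n
    using group_action.burnside[OF group_action_conj[of n]] units(1)
      finite_lists_set_in_length_eq[OF sets]
    by (simp add: orbit_count_def commuting_tuples_eq units_of_carrier Coset.order_def)
  then have "of_nat (orbit_count A n) * rat_of_nat (card (Units A)) =
      (\<Sum>u\<in>Units A. of_nat (card (?I u n)))" for n
    by (metis of_nat_mult of_nat_sum)
  \<comment> \<open>Division by the number of units is legitimate in the rationals, since
    \<open>Units A\<close> is finite and nonempty. It affects only a constant factor, because this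
    number does not depend on \<open>n\<close>.\<close>
  then have "orbit_gf A = fps_const (1 / of_nat (card (Units A))) *
      (\<Sum>u\<in>Units A. Abs_fps (\<lambda>n. of_nat (card (?I u n))))"
    using units by (intro fps_ext) (simp add: orbit_gf_def fps_sum_nth field_simps)
  moreover have "rational_fps (Abs_fps (\<lambda>n. of_nat (card (?I u n))) :: rat fps)" for u
    unfolding invariants_conj_action
    using sets by (intro rational_fps_card_lists_set_in) auto
  ultimately show ?thesis
    by (simp add: rational_fps_mult rational_fps_sum)
qed

end
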